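(* Let $a\in\mathbb{R}$, $f:[a,\infty)\to\mathbb{R}$, $t_0\in(a,\infty)$ and $\alpha\in(0,1)$. Then the conformable derivative $T^{\alpha}_a f(t_0)$ with lower terminal $a$ exists if and only if $f$ has a (usual) first derivative $f'(t_0)$ at $t_0$, and in that case $$T^{\alpha}_a f(t_0)=(t_0-a)^{1-\alpha}f'(t_0).$$
   Context: For $a\in\mathbb{R}$, $\alpha\in(0,1]$, a function $f:[a,\infty)\to\mathbb{R}$ and a point $t\in(a,\infty)$, the (left-sided) conformable derivative of order $\alpha$ of $f$ at $t$ with lower terminal $a$ is $$T^{\alpha}_a f(t)=\lim_{\theta\to 0}\frac{f\big(t+\theta(t-a)^{1-\alpha}\big)-f(t)}{\theta},$$ provided this (finite, two-sided) limit exists. *)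

theory Defs
  imports "HOL-Analysis.Analysis"
begin

text \<open>
  A function on \<open>[a, \<infinity>)\<close> is represented by a total function on the reals. For \<open>t > a\<close> the limits
  below only involve values of \<open>f\<close> near \<open>t\<close>, so its values to the left of \<open>a\<close> play no role.
  The definitions are meant for \<open>0 < \<alpha> \<le> 1\<close> and \<open>t > a\<close>, where \<open>powr\<close> is the ordinary real power.
\<close>

definition has_conformable_derivative ::
    "real \<Rightarrow> real \<Rightarrow> (real \<Rightarrow> real) \<Rightarrow> real \<Rightarrow> real \<Rightarrow> bool" where
  "has_conformable_derivative \<alpha> a f D t \<longleftrightarrow>
     ((\<lambda>\<theta>. (f (t + \<theta> * (t - a) powr (1 - \<alpha>)) - f t) / \<theta>) \<longlongrightarrow> D) (at 0)"

definition conformable_differentiable ::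
    "real \<Rightarrow> real \<Rightarrow> (real \<Rightarrow> real) \<Rightarrow> real \<Rightarrow> bool" where
  "conformable_differentiable \<alpha> a f t \<longleftrightarrow> (\<exists>D. has_conformable_derivative \<alpha> a f D t)"

text \<open>The value is unspecified when the limit does not exist.\<close>

definition conformable_deriv ::
    "real \<Rightarrow> real \<Rightarrow> (real \<Rightarrow> real) \<Rightarrow> real \<Rightarrow> real" where
  "conformable_deriv \<alpha> a f t = (THE D. has_conformable_derivative \<alpha> a f D t)"

end

theory Submission
  imports Defs
begin

text \<open>
  For \<open>t > a\<close> the factor \<open>c = (t - a) powr (1 - \<alpha>)\<close> is a fixed nonzero constant, so the
  conformable difference quotient at \<open>\<theta>\<close> is \<open>c\<close> times the ordinary difference quotient of \<open>f\<close>
  with increment \<open>h = \<theta> * c\<close>. Since \<open>\<theta> \<mapsto> \<theta> * c\<close> maps the punctured neighbourhoods of \<open>0\<close>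
  onto the punctured neighbourhoods of \<open>0\<close>, one quotient converges exactly when the other
  does (\<open>scaled_difference_quotient_tendsto_iff\<close>). Nonvanishing of \<open>c\<close> gives both directions
  of the equivalence and the formula for the value.
\<close>

lemma scaled_difference_quotient_tendsto_iff:
  fixes f :: "'a::real_normed_field \<Rightarrow> 'a"
  assumes "c \<noteq> 0"
  shows "((\<lambda>\<theta>. (f (t + \<theta> * c) - f t) / \<theta>) \<longlongrightarrow> c * D) (at 0) \<longleftrightarrow>
         (f has_field_derivative D) (at t)"
proof -
  have "((\<lambda>\<theta>. (f (t + \<theta> * c) - f t) / \<theta>) \<longlongrightarrow> c * D) (at 0) \<longleftrightarrow>
        ((\<lambda>\<theta>. c * ((f (t + c * \<theta>) - f t) / (c * \<theta>))) \<longlongrightarrow> c * D) (at 0)"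
    using assms by (simp add: mult.commute)
  also have "\<dots> \<longleftrightarrow> ((\<lambda>\<theta>. (f (t + c * \<theta>) - f t) / (c * \<theta>)) \<longlongrightarrow> D) (at 0)"
    using assms by (rule tendsto_mult_left_iff)
  also have "\<dots> \<longleftrightarrow> ((\<lambda>h. (f (t + h) - f t) / h) \<longlongrightarrow> D) (filtermap ((*) c) (at 0))"
    by (simp add: filterlim_filtermap)
  also have "filtermap ((*) c) (at 0) = at (0::'a)"
    using filtermap_nhds_eq_imp_filtermap_at_eq[of "(*) c" 0] filtermap_nhds_times[OF assms, of 0]
      assms by simp
  finally show ?thesis
    by (simp add: DERIV_def)
qed

text \<open>
  Every real \<open>E\<close> has the form \<open>(t - a) powr (1 - \<alpha>) * D\<close>, so stating the candidate value in this
  form covers all of them and keeps division out of the statement.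
\<close>

lemma has_conformable_derivative_iff:
  assumes "a < t"
  shows "has_conformable_derivative \<alpha> a f ((t - a) powr (1 - \<alpha>) * D) t \<longleftrightarrow>
         (f has_real_derivative D) (at t)"
  unfolding has_conformable_derivative_def
  using assms by (intro scaled_difference_quotient_tendsto_iff) simp

lemma has_conformable_derivative_unique:
  assumes "has_conformable_derivative \<alpha> a f D t" and "has_conformable_derivative \<alpha> a f E t"
  shows "D = E"
  using assms unfolding has_conformable_derivative_def
  by (rule tendsto_unique[OF at_neq_bot])

lemma conformable_deriv_eqI:
  assumes "has_conformable_derivative \<alpha> a f D t"
  shows "conformable_deriv \<alpha> a f t = D"
  unfolding conformable_deriv_def
  using assms by (blast intro: has_conformable_derivative_unique)

lemma conformable_differentiable_iff:
  assumes "a < t"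
  shows "conformable_differentiable \<alpha> a f t \<longleftrightarrow> f differentiable (at t)"
proof
  assume "conformable_differentiable \<alpha> a f t"
  then obtain E where E: "has_conformable_derivative \<alpha> a f E t"
    unfolding conformable_differentiable_def by blast
  let ?c = "(t - a) powr (1 - \<alpha>)"
  have "E = ?c * (E / ?c)"
    using assms by simp
  with E have "has_conformable_derivative \<alpha> a f (?c * (E / ?c)) t"
    by simp
  then show "f differentiable (at t)"
    using has_conformable_derivative_iff[OF assms] real_differentiable_def by blast
next
  assume "f differentiable (at t)"
  then show "conformable_differentiable \<alpha> a f t"
    unfolding conformable_differentiable_def
    using has_conformable_derivative_iff[OF assms] real_differentiable_def by blast
qed

theorem corollary3p4:
  fixes a t\<^sub>0 \<alpha> :: real and f :: "real \<Rightarrow> real"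
  assumes "a < t\<^sub>0" and "0 < \<alpha>" and "\<alpha> < 1"
  shows "(conformable_differentiable \<alpha> a f t\<^sub>0 \<longleftrightarrow> f differentiable (at t\<^sub>0)) \<and>
         (conformable_differentiable \<alpha> a f t\<^sub>0 \<longrightarrow>
            conformable_deriv \<alpha> a f t\<^sub>0 = (t\<^sub>0 - a) powr (1 - \<alpha>) * deriv f t\<^sub>0)"
proof (intro conjI impI)
  show iff: "conformable_differentiable \<alpha> a f t\<^sub>0 \<longleftrightarrow> f differentiable (at t\<^sub>0)"
    using assms(1) by (rule conformable_differentiable_iff)
  assume "conformable_differentiable \<alpha> a f t\<^sub>0"
  with iff have "(f has_real_derivative deriv f t\<^sub>0) (at t\<^sub>0)"
    using DERIV_deriv_iff_real_differentiable by blast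
  then show "conformable_deriv \<alpha> a f t\<^sub>0 = (t\<^sub>0 - a) powr (1 - \<alpha>) * deriv f t\<^sub>0"
    using has_conformable_derivative_iff[OF assms(1)] conformable_deriv_eqI by blast
qed

end
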